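(* For the prism (circular ladder graph) $D_n$ on $2n$ vertices, $n\ge3$, with its standard plane embedding (two $n$-gonal faces and $n$ quadrangular faces), $\pi_{fl}(D_n)\le 8$.
   Context: $D_n$ is the Cartesian product $C_n\square P_2$, i.e. two $n$-cycles $v_1\dots v_n$ and $u_1\dots u_n$ with edges $u_iv_i$. A sequence $r_1\dots r_{2n}$ is a repetition if $r_i=r_{n+i}$ for all $i\le n$. In a plane graph $G$, a facial path is a path whose vertices and edges are consecutive on the boundary walk of some face of $G$. A vertex colouring is facial non-repetitive if no facial path on vertices $v_1,\dots,v_{2n}$ ($n\ge1$) has colour sequence that is a repetition. $\pi_{fl}(G)$ is the minimum $l$ such that for every assignment of lists $L(v)\subseteq\mathbb{Z}_+$ with $|L(v)|\ge l$ there is a facial non-repetitive colouring $\varphi$ with $\varphi(v)\in L(v)$ for every vertex $v$. *)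

theory Defs
  imports "Graph_Theory.Graph_Theory" "HOL-Library.Extended_Nat"
begin

section \<open>Facial non-repetitive list colourings of plane graphs\<close>

text \<open>
  Finite simple graphs are symmetric loop-free digraphs (\<^locale>\<open>pair_graph\<close>). A plane
  embedding of a connected graph is given by its rotation system: \<open>rot\<close> maps every arc
  to the next arc with the same tail, anticlockwise around that tail. The boundary walk of
  a face that starts with the arc \<open>a\<close> follows the iterates of \<open>face_succ rot\<close> on \<open>a\<close>, and
  faces are the orbits of \<open>face_succ rot\<close>. The embedding is into the sphere (equivalently,
  the plane) iff Euler's formula holds; as the graph is symmetric, it has
  \<open>card (parcs G) div 2\<close> edges.
\<close>

definition face_succ :: "('a \<times> 'a \<Rightarrow> 'a \<times> 'a) \<Rightarrow> 'a \<times> 'a \<Rightarrow> 'a \<times> 'a" where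
  "face_succ rot a = rot (prod.swap a)"

definition faces :: "'a pair_pre_digraph \<Rightarrow> ('a \<times> 'a \<Rightarrow> 'a \<times> 'a) \<Rightarrow> ('a \<times> 'a) set set" where
  "faces G rot = orbit (face_succ rot) ` parcs G"

locale plane_map = pair_graph G for G :: "'a pair_pre_digraph" +
  fixes rot :: "'a \<times> 'a \<Rightarrow> 'a \<times> 'a"
  assumes rot_cyclic: "v \<in> pverts G \<Longrightarrow> cyclic_on rot (out_arcs G v)"
    and connected: "connected G"
    and euler: "card (pverts G) + card (faces G rot) = card (parcs G) div 2 + 2"

definition follows_boundary ::
    "'a pair_pre_digraph \<Rightarrow> ('a \<times> 'a \<Rightarrow> 'a \<times> 'a) \<Rightarrow> 'a list \<Rightarrow> bool" where
  "follows_boundary G rot p \<longleftrightarrow>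
     (\<exists>a\<in>parcs G. \<forall>i<length p. p ! i = fst ((face_succ rot ^^ i) a))"

text \<open>Boundary walks are oriented by \<open>face_succ\<close>, but a path may traverse them either way.\<close>

definition facial_path ::
    "'a pair_pre_digraph \<Rightarrow> ('a \<times> 'a \<Rightarrow> 'a \<times> 'a) \<Rightarrow> 'a list \<Rightarrow> bool" where
  "facial_path G rot p \<longleftrightarrow>
     p \<noteq> [] \<and> distinct p \<and> (follows_boundary G rot p \<or> follows_boundary G rot (rev p))"

definition repetition :: "'c list \<Rightarrow> bool" where
  "repetition r \<longleftrightarrow> (\<exists>n\<ge>1. length r = 2 * n \<and> (\<forall>i<n. r ! i = r ! (n + i)))"

definition facial_nonrepetitive ::
    "'a pair_pre_digraph \<Rightarrow> ('a \<times> 'a \<Rightarrow> 'a \<times> 'a) \<Rightarrow> ('a \<Rightarrow> 'c) \<Rightarrow> bool" where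
  "facial_nonrepetitive G rot \<phi> \<longleftrightarrow>
     (\<forall>p. facial_path G rot p \<longrightarrow> \<not> repetition (map \<phi> p))"

text \<open>Infinite lists are admitted; their \<^const>\<open>card\<close> is 0, hence the guard below.\<close>

definition facial_nonrep_choosable ::
    "'a pair_pre_digraph \<Rightarrow> ('a \<times> 'a \<Rightarrow> 'a \<times> 'a) \<Rightarrow> nat \<Rightarrow> bool" where
  "facial_nonrep_choosable G rot l \<longleftrightarrow>
     (\<forall>L :: 'a \<Rightarrow> nat set.
        (\<forall>v\<in>pverts G. L v \<subseteq> {1..} \<and> (finite (L v) \<longrightarrow> l \<le> card (L v))) \<longrightarrow>
        (\<exists>\<phi>. (\<forall>v\<in>pverts G. \<phi> v \<in> L v) \<and> facial_nonrepetitive G rot \<phi>))"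

text \<open>The minimum is taken in \<^typ>\<open>enat\<close>, so that it is \<open>\<infinity>\<close> if no \<open>l\<close> suffices.\<close>

definition pi_fl :: "'a pair_pre_digraph \<Rightarrow> ('a \<times> 'a \<Rightarrow> 'a \<times> 'a) \<Rightarrow> enat" where
  "pi_fl G rot = (INF l \<in> {l. facial_nonrep_choosable G rot l}. enat l)"


section \<open>Prisms\<close>

definition cycle_graph :: "nat \<Rightarrow> nat pair_pre_digraph" where
  "cycle_graph n = \<lparr> pverts = {..<n},
     parcs = {(i, j). i < n \<and> j < n \<and> (j = Suc i mod n \<or> i = Suc j mod n)} \<rparr>"

definition path_graph :: "nat \<Rightarrow> nat pair_pre_digraph" where
  "path_graph n = \<lparr> pverts = {..<n},
     parcs = {(i, j). i < n \<and> j < n \<and> (j = Suc i \<or> i = Suc j)} \<rparr>"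

definition cartesian_product ::
    "'a pair_pre_digraph \<Rightarrow> 'b pair_pre_digraph \<Rightarrow> ('a \<times> 'b) pair_pre_digraph" where
  "cartesian_product G H = \<lparr> pverts = pverts G \<times> pverts H,
     parcs = {((a, b), (c, d)).
       a = c \<and> a \<in> pverts G \<and> (b, d) \<in> parcs H \<or> b = d \<and> b \<in> pverts H \<and> (a, c) \<in> parcs G} \<rparr>"

definition prism :: "nat \<Rightarrow> (nat \<times> nat) pair_pre_digraph" where
  "prism n = cartesian_product (cycle_graph n) (path_graph 2)"

text \<open>
  Standard drawing: \<open>(i, s)\<close> is placed at angle \<open>2\<pi>i/n\<close> on the circle of radius \<open>s + 1\<close>.
  Anticlockwise, the neighbours of \<open>(i, 0)\<close> are \<open>(i, 1)\<close>, \<open>(i + 1, 0)\<close>, \<open>(i - 1, 0)\<close>, and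
  those of \<open>(i, 1)\<close> are \<open>(i + 1, 1)\<close>, \<open>(i, 0)\<close>, \<open>(i - 1, 1)\<close>, with first components
  modulo \<open>n\<close>.
\<close>

fun prism_rot :: "nat \<Rightarrow> (nat \<times> nat) \<times> (nat \<times> nat) \<Rightarrow> (nat \<times> nat) \<times> (nat \<times> nat)" where
  "prism_rot n ((i, s), (j, t)) = ((i, s),
     (let succ = Suc i mod n; pred = (i + n - 1) mod n in
      if s \<noteq> t then (if s = 0 then (succ, 0) else (pred, 1))
      else if j = succ then (if s = 0 then (pred, 0) else (i, 0))
      else (if s = 0 then (i, 1) else (succ, 1))))"


subsection \<open>The embedding of the prism\<close>

definition inner_arc :: "nat \<Rightarrow> nat \<Rightarrow> (nat \<times> nat) \<times> (nat \<times> nat)" where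
  "inner_arc n i = ((Suc i mod n, 0), (i, 0))"

definition outer_arc :: "nat \<Rightarrow> nat \<Rightarrow> (nat \<times> nat) \<times> (nat \<times> nat)" where
  "outer_arc n i = ((i, 1), (Suc i mod n, 1))"

definition quad_arcs :: "nat \<Rightarrow> nat \<Rightarrow> ((nat \<times> nat) \<times> (nat \<times> nat)) set" where
  "quad_arcs n i = {((i, 0), (Suc i mod n, 0)), ((Suc i mod n, 0), (Suc i mod n, 1)),
     ((Suc i mod n, 1), (i, 1)), ((i, 1), (i, 0))}"

lemma Suc_mod_if: "i < n \<Longrightarrow> Suc i mod n = (if Suc i = n then 0 else Suc i)"
  by auto

lemma pred_mod_if: "i < n \<Longrightarrow> (i + n - Suc 0) mod n = (if i = 0 then n - Suc 0 else i - Suc 0)"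
proof (cases i)
  case (Suc k)
  assume "i < n"
  then have "(k + n) mod n = k" using Suc by simp
  then show ?thesis using Suc by simp
qed simp

lemma pred_Suc_mod: "i < n \<Longrightarrow> (Suc i mod n + n - Suc 0) mod n = i"
  by (auto simp: Suc_mod_if)

lemma parcs_prism: "parcs (prism n) =
  {((i, s), (j, t)). i < n \<and> j < n \<and> s < 2 \<and> t < 2 \<and>
    (i = j \<and> s \<noteq> t \<or> s = t \<and> (j = Suc i mod n \<or> i = Suc j mod n))}"
  by (auto simp: prism_def cartesian_product_def cycle_graph_def path_graph_def)

lemma pverts_prism: "pverts (prism n) = {..<n} \<times> {..<2}"
  by (simp add: prism_def cartesian_product_def cycle_graph_def path_graph_def)

lemma less_2: "(s :: nat) < 2 \<longleftrightarrow> s = 0 \<or> s = 1"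
  by auto

lemma parcs_prism_faces: "parcs (prism n) =
  inner_arc n ` {..<n} \<union> outer_arc n ` {..<n} \<union> (\<Union>i<n. quad_arcs n i)"
proof (rule set_eqI, clarify)
  fix i s j t
  show "((i, s), (j, t)) \<in> parcs (prism n) \<longleftrightarrow> ((i, s), (j, t)) \<in>
    inner_arc n ` {..<n} \<union> outer_arc n ` {..<n} \<union> (\<Union>i<n. quad_arcs n i)"
  proof (cases "i < n \<and> j < n")
    case True
    have "\<exists>k<n. Suc k mod n = i"
      using True pred_mod_if[of i n]
      by (intro exI[of _ "if i = 0 then n - 1 else i - 1"]) auto
    then obtain k where "k < n" "Suc k mod n = i" by blast
    then show ?thesis using True
      by (auto simp: parcs_prism inner_arc_def outer_arc_def quad_arcs_def less_2)
  next
    case False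
    then show ?thesis
      by (auto simp: parcs_prism inner_arc_def outer_arc_def quad_arcs_def less_2)
  qed
qed

lemma orbit_cycleI:
  assumes step: "\<And>i. i < n \<Longrightarrow> f (c i) = c (Suc i mod n)" and i: "i < n"
  shows "orbit f (c i) = c ` {..<n}"
proof -
  have it: "(f ^^ k) (c i) = c ((i + k) mod n)" for k
    using i by (induction k) (auto simp: step mod_Suc_eq)
  show ?thesis
  proof (intro equalityI subsetI)
    fix x assume "x \<in> orbit f (c i)"
    then show "x \<in> c ` {..<n}" using i it by (auto simp: orbit_altdef)
  next
    fix x assume "x \<in> c ` {..<n}"
    then obtain j where j: "j < n" "x = c j" by auto
    have "(f ^^ (n + j - i)) (c i) = x" using i j it by auto
    moreover have "0 < n + j - i" using i by simp
    ultimately show "x \<in> orbit f (c i)" by (auto simp: orbit_altdef)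
  qed
qed

lemma orbit_cycle_revI:
  assumes step: "\<And>i. i < n \<Longrightarrow> f (c (Suc i mod n)) = c i" and i: "i < n"
  shows "orbit f (c i) = c ` {..<n}"
proof -
  have it: "(f ^^ k) (c ((j + k) mod n)) = c j" if "j < n" for k j
    using that
  proof (induction k)
    case (Suc k)
    have "(j + k) mod n < n" using Suc.prems by simp
    from step[OF this] have "f (c ((j + Suc k) mod n)) = c ((j + k) mod n)"
      by (simp add: mod_Suc_eq)
    then show ?case using Suc by (simp add: funpow_swap1)
  qed simp
  have cl: "(f ^^ k) (c i) \<in> c ` {..<n}" for k
  proof (induction k)
    case (Suc k)
    then obtain j where j: "j < n" "(f ^^ k) (c i) = c j" by auto
    have "Suc ((j + n - Suc 0) mod n) mod n = j" using j(1)
      by (cases "j = 0") (simp_all add: pred_mod_if)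
    moreover have "(j + n - Suc 0) mod n < n" using j(1) by simp
    ultimately have "f (c j) = c ((j + n - Suc 0) mod n)"
      using step by metis
    then show ?case using j by auto
  qed (use i in auto)
  show ?thesis
  proof (intro equalityI subsetI)
    fix x assume "x \<in> orbit f (c i)"
    then show "x \<in> c ` {..<n}" using cl by (auto simp: orbit_altdef)
  next
    fix x assume "x \<in> c ` {..<n}"
    then obtain j where j: "j < n" "x = c j" by auto
    have "(j + (n + i - j)) mod n = i" using i j by auto
    then have "(f ^^ (n + i - j)) (c i) = x" using it[of j "n + i - j"] j by auto
    moreover have "0 < n + i - j" using j by simp
    ultimately show "x \<in> orbit f (c i)" by (auto simp: orbit_altdef)
  qed
qed

lemma orbit_4:
  assumes "f a = b" "f b = c" "f c = d" "f d = a"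
  shows "orbit f a = {a, b, c, d}"
proof (intro equalityI subsetI)
  fix x assume "x \<in> orbit f a"
  then show "x \<in> {a, b, c, d}" by induction (use assms in auto)
next
  fix x assume x: "x \<in> {a, b, c, d}"
  have "b \<in> orbit f a" using orbit.base[of f a] assms by simp
  moreover from this have "c \<in> orbit f a" using orbit.step[of b f a] assms by simp
  moreover from this have "d \<in> orbit f a" using orbit.step[of c f a] assms by simp
  moreover from this have "a \<in> orbit f a" using orbit.step[of d f a] assms by simp
  ultimately show "x \<in> orbit f a" using x by auto
qed

context
  fixes n :: nat
  assumes n: "n \<ge> 3"
begin

lemma Suc_mod_neq: "i < n \<Longrightarrow> Suc i mod n \<noteq> i"
  "i < n \<Longrightarrow> Suc (Suc i mod n) mod n \<noteq> i"
  using n by (auto simp: mod_Suc)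

lemma face_succ_inner:
  "i < n \<Longrightarrow> face_succ (prism_rot n) (inner_arc n (Suc i mod n)) = inner_arc n i"
  using n by (auto simp: face_succ_def inner_arc_def Let_def pred_Suc_mod Suc_mod_neq)

lemma face_succ_outer:
  "i < n \<Longrightarrow> face_succ (prism_rot n) (outer_arc n i) = outer_arc n (Suc i mod n)"
  using n Suc_mod_neq(2)[of i] by (auto simp: face_succ_def outer_arc_def Let_def)

lemma face_succ_quad:
  assumes "i < n"
  shows "face_succ (prism_rot n) ((i, 0), (Suc i mod n, 0)) = ((Suc i mod n, 0), (Suc i mod n, 1))"
    "face_succ (prism_rot n) ((Suc i mod n, 0), (Suc i mod n, 1)) = ((Suc i mod n, 1), (i, 1))"
    "face_succ (prism_rot n) ((Suc i mod n, 1), (i, 1)) = ((i, 1), (i, 0))"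
    "face_succ (prism_rot n) ((i, 1), (i, 0)) = ((i, 0), (Suc i mod n, 0))"
  using assms Suc_mod_neq(2)[of i] by (auto simp: face_succ_def Let_def pred_Suc_mod)

lemma quad_orbit:
  assumes "i < n" "a \<in> quad_arcs n i"
  shows "orbit (face_succ (prism_rot n)) a = quad_arcs n i"
proof -
  note [simp del] = One_nat_def
  note f = face_succ_quad[OF assms(1)]
  show ?thesis using assms(2)
    orbit_4[of "face_succ (prism_rot n)", OF f(1) f(2) f(3) f(4)]
    orbit_4[of "face_succ (prism_rot n)", OF f(2) f(3) f(4) f(1)]
    orbit_4[of "face_succ (prism_rot n)", OF f(3) f(4) f(1) f(2)]
    orbit_4[of "face_succ (prism_rot n)", OF f(4) f(1) f(2) f(3)]
    unfolding quad_arcs_def by (elim insertE emptyE) auto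
qed

theorem faces_prism: "faces (prism n) (prism_rot n) =
  {inner_arc n ` {..<n}, outer_arc n ` {..<n}} \<union> quad_arcs n ` {..<n}"
proof -
  let ?o = "orbit (face_succ (prism_rot n))"
  have i: "?o ` inner_arc n ` {..<n} = {inner_arc n ` {..<n}}"
  proof -
    have "?o (inner_arc n i) = inner_arc n ` {..<n}" if "i < n" for i
      using that face_succ_inner by (intro orbit_cycle_revI) auto
    then have "?o ` inner_arc n ` {..<n} = (\<lambda>_. inner_arc n ` {..<n}) ` {..<n}"
      unfolding image_image by (intro image_cong) auto
    then show ?thesis using n by (simp add: image_constant_conv lessThan_empty_iff)
  qed
  have o: "?o ` outer_arc n ` {..<n} = {outer_arc n ` {..<n}}"
  proof -
    have "?o (outer_arc n i) = outer_arc n ` {..<n}" if "i < n" for i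
      using that face_succ_outer by (intro orbit_cycleI) auto
    then have "?o ` outer_arc n ` {..<n} = (\<lambda>_. outer_arc n ` {..<n}) ` {..<n}"
      unfolding image_image by (intro image_cong) auto
    then show ?thesis using n by (simp add: image_constant_conv lessThan_empty_iff)
  qed
  have q: "?o ` (\<Union>i<n. quad_arcs n i) = quad_arcs n ` {..<n}"
  proof (intro equalityI subsetI)
    fix F assume "F \<in> quad_arcs n ` {..<n}"
    then obtain i where "i < n" "F = quad_arcs n i" by auto
    then have "F = ?o ((i, 1), (i, 0))" "((i, 1), (i, 0)) \<in> quad_arcs n i"
      using quad_orbit[of i "((i, 1), (i, 0))"] by (auto simp: quad_arcs_def)
    then show "F \<in> ?o ` (\<Union>i<n. quad_arcs n i)" using \<open>i < n\<close> by blast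
  qed (use quad_orbit in auto)
  show ?thesis unfolding faces_def parcs_prism_faces image_Un i o q by auto
qed

lemma card_faces_prism: "card (faces (prism n) (prism_rot n)) = n + 2"
proof -
  have "inj_on (quad_arcs n) {..<n}"
    by (rule inj_onI) (auto simp: quad_arcs_def set_eq_iff)
  then have q: "card (quad_arcs n ` {..<n}) = n" by (simp add: card_image)
  have io: "inner_arc n ` {..<n} \<noteq> outer_arc n ` {..<n}"
  proof -
    have "inner_arc n 0 \<in> inner_arc n ` {..<n}" using n by auto
    moreover have "inner_arc n 0 \<notin> outer_arc n ` {..<n}"
      by (auto simp: inner_arc_def outer_arc_def)
    ultimately show ?thesis by metis
  qed
  have "inner_arc n ` {..<n} \<notin> quad_arcs n ` {..<n}" "outer_arc n ` {..<n} \<notin> quad_arcs n ` {..<n}"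
    by (auto simp: inner_arc_def outer_arc_def quad_arcs_def set_eq_iff image_iff)
  then show ?thesis unfolding faces_prism using q io by simp
qed

lemma card_parcs_prism: "card (parcs (prism n)) = 6 * n"
proof -
  define g :: "nat \<times> nat \<Rightarrow> (nat \<times> nat) \<times> (nat \<times> nat)" where
    "g = (\<lambda>(i, k). [inner_arc n i, outer_arc n i, ((i, 0), (Suc i mod n, 0)),
       ((i, 0), (i, 1)), ((Suc i mod n, 1), (i, 1)), ((i, 1), (i, 0))] ! k)"
  have six: "{..<6} = {0, 1, 2, 3, 4, 5 :: nat}" by auto
  have "parcs (prism n) = g ` ({..<n} \<times> {..<6})"
  proof -
    have "g ` ({..<n} \<times> {..<6}) = (\<Union>i<n. (\<lambda>k. g (i, k)) ` {..<6})" by auto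
    also have "\<dots> = parcs (prism n)"
    proof (rule set_eqI, clarify)
      fix i s j t
      show "((i, s), (j, t)) \<in> (\<Union>i<n. (\<lambda>k. g (i, k)) ` {..<6}) \<longleftrightarrow>
          ((i, s), (j, t)) \<in> parcs (prism n)"
        unfolding six g_def
        by (auto simp: parcs_prism inner_arc_def outer_arc_def less_2)
    qed
    finally show ?thesis by simp
  qed
  moreover have "inj_on g ({..<n} \<times> {..<6})"
  proof (rule inj_onI, clarify)
    fix i k j l assume *: "i < n" "j < n" "k < 6" "l < 6" "g (i, k) = g (j, l)"
    have "k \<in> {0, 1, 2, 3, 4, 5}" "l \<in> {0, 1, 2, 3, 4, 5}" using * by auto
    then show "i = j \<and> k = l" using * Suc_mod_neq[of i] Suc_mod_neq[of j]
      by (elim insertE emptyE) (auto simp: g_def inner_arc_def outer_arc_def)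
  qed
  ultimately show ?thesis by (simp add: card_image)
qed

lemma reach_prism:
  assumes "i < n" "s < 2"
  shows "((0, 0), (i, s)) \<in> (parcs (prism n))\<^sup>*"
proof -
  have row: "((0, 0), (i, 0)) \<in> (parcs (prism n))\<^sup>*" using assms(1)
  proof (induction i)
    case (Suc i)
    then have "((i, 0), (Suc i, 0)) \<in> parcs (prism n)" by (auto simp: parcs_prism)
    then show ?case using Suc by (meson Suc_lessD rtrancl.rtrancl_into_rtrancl)
  qed simp
  have "s = 0 \<or> ((i, 0), (i, s)) \<in> parcs (prism n)"
    using assms by (auto simp: parcs_prism)
  then show ?thesis using row by (auto intro: rtrancl.rtrancl_into_rtrancl)
qed

lemma sym_parcs_prism: "sym (parcs (prism n))"
  by (auto simp: sym_def parcs_prism)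

lemma pair_graph_prism: "pair_graph (prism n)"
proof
  show "finite (parcs (prism n))" using card_parcs_prism n by (intro card_ge_0_finite) simp
  show "symmetric (prism n)" using sym_parcs_prism by (simp add: symmetric_def)
qed (use n in \<open>auto simp: parcs_prism pverts_prism Suc_mod_neq\<close>,
     use Suc_mod_neq(1) in metis)

lemma prism_rot_cyclic:
  assumes "v \<in> pverts (prism n)"
  shows "cyclic_on (prism_rot n) (out_arcs (prism n) v)"
proof -
  obtain i s where v: "v = (i, s)" "i < n" "s = 0 \<or> s = 1"
    using assms by (auto simp: pverts_prism less_2)
  let ?p = "(i + n - 1) mod n" and ?q = "Suc i mod n" and ?r = "prism_rot n"
  have p: "?p < n" "Suc ?p mod n = i" "?p \<noteq> ?q" "?q < n"
    using n v(2) by (auto simp: pred_mod_if Suc_mod_if)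
  have uniq: "j = ?p" if "j < n" "i = Suc j mod n" for j
    using that pred_Suc_mod[of j n] by simp
  have out: "out_arcs (prism n) v = {(v, (i, 1 - s)), (v, (?q, s)), (v, (?p, s))}"
  proof (rule set_eqI, clarify)
    fix a b j t
    have "i = Suc j mod n \<longleftrightarrow> j = ?p" if "j < n"
      using that uniq p(2) by metis
    then show "((a, b), (j, t)) \<in> out_arcs (prism n) v \<longleftrightarrow>
        ((a, b), (j, t)) \<in> {(v, (i, 1 - s)), (v, (?q, s)), (v, (?p, s))}"
      using v p(1,4) by (auto simp: out_arcs_def parcs_prism simp del: One_nat_def)
  qed
  have "out_arcs (prism n) v = orbit ?r (v, (i, 1 - s))"
  proof -
    have r0: "?r (v, (i, 1 - s)) = (v, (?q, s))" "?r (v, (?q, s)) = (v, (?p, s))"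
      "?r (v, (?p, s)) = (v, (i, 1 - s))" if "s = 0"
      using that p(3) v(1) by (simp_all add: Let_def)
    have r1: "?r (v, (i, 1 - s)) = (v, (?p, s))" "?r (v, (?p, s)) = (v, (?q, s))"
      "?r (v, (?q, s)) = (v, (i, 1 - s))" if "s = 1"
      using that p(3) v(1) by (simp_all add: Let_def)
    have orbit_3: "orbit f a = {a, b, c}" if "f a = b" "f b = c" "f c = a"
      for f and a b c :: "(nat \<times> nat) \<times> (nat \<times> nat)"
    proof (intro equalityI subsetI)
      fix x assume "x \<in> orbit f a"
      then show "x \<in> {a, b, c}" by induction (use that in auto)
    next
      fix x assume x: "x \<in> {a, b, c}"
      have "b \<in> orbit f a" using orbit.base[of f a] that by simp
      moreover from this have "c \<in> orbit f a" using orbit.step[of b f a] that by simp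
      moreover from this have "a \<in> orbit f a" using orbit.step[of c f a] that by simp
      ultimately show "x \<in> orbit f a" using x by auto
    qed
    show ?thesis using v(3)
    proof
      assume "s = 0"
      from orbit_3[OF r0[OF this]] show ?thesis unfolding out by simp
    next
      assume "s = 1"
      from orbit_3[OF r1[OF this]] show ?thesis unfolding out by auto
    qed
  qed
  moreover have "(v, (i, 1 - s)) \<in> out_arcs (prism n) v" unfolding out by simp
  ultimately show ?thesis by (auto simp: cyclic_on_def)
qed

theorem plane_map_prism: "plane_map (prism n) (prism_rot n)"
proof -
  interpret pair_graph "prism n" by (rule pair_graph_prism)
  show ?thesis
  proof
    fix v assume "v \<in> pverts (prism n)"
    then show "cyclic_on (prism_rot n) (out_arcs (prism n) v)" by (rule prism_rot_cyclic)
  next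
    have mk: "parcs (mk_symmetric (prism n)) = parcs (prism n)"
      "pverts (mk_symmetric (prism n)) = pverts (prism n)"
      using sym_parcs_prism by (auto simp: mk_symmetric_def sym_def)
    have "(u, v) \<in> rtrancl_on (pverts (prism n)) (parcs (prism n))"
      if "u \<in> pverts (prism n)" "v \<in> pverts (prism n)" for u v
    proof -
      have "((0, 0), u) \<in> (parcs (prism n))\<^sup>*" "((0, 0), v) \<in> (parcs (prism n))\<^sup>*"
        using that reach_prism by (auto simp: pverts_prism)
      then have "(u, v) \<in> (parcs (prism n))\<^sup>*"
        using sym_rtrancl[OF sym_parcs_prism] by (meson rtrancl_trans symD)
      then show ?thesis
      proof (induction rule: rtrancl_induct)
        case base
        then show ?case using that by (rule_tac rtrancl_on_refl)
      next
        case (step y z)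
        then show ?case using in_arcsD2 by (meson rtrancl_on_into_rtrancl_on arc_fst_in_verts)
      qed
    qed
    then show "connected (prism n)" using n
      by (auto simp: connected_def strongly_connected_def reachable_def mk pverts_prism lessThan_empty_iff)
  next
    show "card (pverts (prism n)) + card (faces (prism n) (prism_rot n)) =
        card (parcs (prism n)) div 2 + 2"
      by (simp add: card_faces_prism card_parcs_prism pverts_prism)
  qed
qed

end

end

theory Submission
  imports Defs
begin

text \<open>
  A cycle has a non-repetitive colouring from lists of size 6, by Rosenfeld's counting method:
  lengthening an interval of the cycle by one vertex, at either end, multiplies the number of
  its square-free colourings by at least 4, since the squares of half-length \<open>k\<close> destroy at most
  a fraction \<open>4 ^ - (k - 1)\<close> of the current number and \<open>6 - 4 / 3 \<ge> 4\<close>. For the vertex that closes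
  the cycle there are \<open>2 k\<close> such squares, and \<open>(\<Sum>k\<ge>1. 2 k / 4 ^ (k - 1)) = 32 / 9 < 6\<close>, so that
  some colouring survives.

  Colour the outer cycle of the prism this way, delete the colours of \<open>(i, 1)\<close> and \<open>(i + 1, 1)\<close>
  from the list of \<open>(i, 0)\<close>, and colour the inner cycle from the remaining lists of size 6. The
  quadrangles take care of themselves: a repetition on four vertices would make both diagonals
  monochromatic, but one end of the diagonal from \<open>(i, 0)\<close> to \<open>(i + 1, 1)\<close> avoids the colour of
  the other.
\<close>

section \<open>Arcs and squares on a cycle, and square-free colourings of vertex sets\<close>

text \<open>The start \<open>s\<close> may be \<open>n\<close> or more, so that the second half of a
  square at \<open>s\<close> is simply \<open>arc n (s + k) k\<close>.\<close>

definition arc :: "nat \<Rightarrow> nat \<Rightarrow> nat \<Rightarrow> nat set" where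
  "arc n s k = (\<lambda>i. (s + i) mod n) ` {..<k}"

definition square :: "nat \<Rightarrow> (nat \<Rightarrow> 'c) \<Rightarrow> nat \<Rightarrow> nat \<Rightarrow> bool" where
  "square n f s k \<longleftrightarrow> (\<forall>i<k. f ((s + i) mod n) = f ((s + k + i) mod n))"

text \<open>\<open>Pi\<^sub>E\<close> fixes the values off \<open>X\<close>, so \<open>card\<close>
  counts colourings of \<open>X\<close> itself. Since \<open>2 * k \<le> n\<close>, the positions of
  a square are distinct; squares that wrap around count as soon as \<open>X\<close> contains their
  arc.\<close>

definition squarefree_colourings ::
    "nat \<Rightarrow> (nat \<Rightarrow> 'c set) \<Rightarrow> nat set \<Rightarrow> (nat \<Rightarrow> 'c) set" where
  "squarefree_colourings n L X = {f \<in> Pi\<^sub>E X L.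
     \<forall>s k. s < n \<and> 1 \<le> k \<and> 2 * k \<le> n \<and> arc n s (2 * k) \<subseteq> X \<longrightarrow> \<not> square n f s k}"

lemma arc_add: "arc n s (k + l) = arc n s k \<union> arc n (s + k) l"
proof -
  have "{..<k + l} = {..<k} \<union> (\<lambda>i. k + i) ` {..<l}"
    using lessThan_atLeast0 ivl_disj_un_one(2)[of k "k + l"] by (simp add: add.commute)
  then show ?thesis
    unfolding arc_def by (simp add: image_Un image_image add.assoc)
qed

lemma arc_eq_interval: "s + k \<le> n \<Longrightarrow> arc n s k = {s..<s + k}"
proof -
  assume "s + k \<le> n"
  then have "arc n s k = (\<lambda>i. s + i) ` {..<k}"
    unfolding arc_def by (intro image_cong) auto
  then show ?thesis by (simp add: lessThan_atLeast0 add.commute)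
qed

lemma add_mod_inj:
  assumes "(s + i) mod n = (s + j) mod n" "i < n" "j < n"
  shows "i = (j :: nat)"
  using assms
proof (induction i j rule: linorder_wlog)
  case (le i j)
  then have "n dvd (s + j) - (s + i)" by (metis add_le_cancel_left mod_eq_dvd_iff_nat)
  then show ?case using le by (auto dest: dvd_imp_le)
qed simp

lemma arc_halves_disjoint:
  assumes "2 * k \<le> n" shows "arc n s k \<inter> arc n (s + k) k = {}"
proof -
  have "(s + i) mod n \<noteq> (s + (k + j)) mod n" if "i < k" "j < k" for i j
    using add_mod_inj[of s i n "k + j"] that assms by auto
  then show ?thesis by (auto simp: arc_def add.assoc)
qed

text \<open>An arc that wraps around passes through \<open>n - 1\<close>, which \<open>X\<close>
  avoids. Hence only the vertex that closes the cycle meets cyclic squares.\<close>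

lemma arc_inside:
  assumes "arc n s k \<subseteq> X" "X \<subseteq> {..<n - 1}" "s < n"
  shows "s + k \<le> n" "arc n s k = {s..<s + k}"
proof -
  show "s + k \<le> n"
  proof (rule ccontr)
    assume "\<not> s + k \<le> n"
    then have "(s + (n - 1 - s)) mod n \<in> arc n s k"
      using assms(3) unfolding arc_def by (intro imageI) auto
    then show False using assms by auto
  qed
  then show "arc n s k = {s..<s + k}" by (rule arc_eq_interval)
qed

lemma square_restrict:
  "arc n s (2 * k) \<subseteq> Y \<Longrightarrow> square n (restrict f Y) s k = square n f s k"
proof -
  assume a: "arc n s (2 * k) \<subseteq> Y"
  have "(s + i) mod n \<in> Y" "(s + k + i) mod n \<in> Y" if "i < k" for i
    using a that unfolding mult_2 arc_add by (auto simp: arc_def)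
  then show ?thesis by (simp add: square_def)
qed

lemma squarefree_colourings_restrict:
  assumes "f \<in> squarefree_colourings n L X" "Y \<subseteq> X"
  shows "restrict f Y \<in> squarefree_colourings n L Y"
  using assms unfolding squarefree_colourings_def
  by (auto simp: square_restrict)

lemma finite_squarefree_colourings:
  "finite X \<Longrightarrow> (\<And>u. u \<in> X \<Longrightarrow> finite (L u)) \<Longrightarrow> finite (squarefree_colourings n L X)"
  unfolding squarefree_colourings_def
  by (rule finite_subset[of _ "Pi\<^sub>E X L"]) (auto intro: finite_PiE)

section \<open>Counting the extensions by one vertex\<close>

text \<open>\<open>t\<close> is the start of the half that contains \<open>v\<close>. Forgetting
  this half is injective: the other half avoids \<open>v\<close>, so it lies in
  \<open>X - arc n t k\<close>, and it carries the same colours.\<close>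

lemma card_squares_le:
  assumes fin: "finite X" "\<And>u. u \<in> X \<Longrightarrow> finite (L u)"
    and k: "2 * k \<le> n" and t: "t = s \<or> t = s + k" and v: "v \<in> arc n t k"
    and sub: "arc n s (2 * k) \<subseteq> insert v X"
  shows "card {f \<in> Pi\<^sub>E (insert v X) L. restrict f X \<in> squarefree_colourings n L X \<and> square n f s k}
    \<le> card (squarefree_colourings n L (X - arc n t k))"
    (is "card ?B \<le> card ?G")
proof (rule card_inj_on_le)
  let ?Y = "X - arc n t k"
  show "finite ?G" using fin by (intro finite_squarefree_colourings) auto
  show "(\<lambda>f. restrict f ?Y) ` ?B \<subseteq> ?G"
  proof clarify
    fix f assume "restrict f X \<in> squarefree_colourings n L X"
    from squarefree_colourings_restrict[OF this, of ?Y]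
    show "restrict f ?Y \<in> ?G" by (simp add: Int_absorb1 Diff_subset)
  qed
  show "inj_on (\<lambda>f. restrict f ?Y) ?B"
  proof (rule inj_onI, clarify)
    fix f g assume f: "f \<in> Pi\<^sub>E (insert v X) L" "square n f s k"
      and g: "g \<in> Pi\<^sub>E (insert v X) L" "square n g s k"
      and eq: "restrict f ?Y = restrict g ?Y"
    have eqY: "f u = g u" if "u \<in> ?Y" for u
      using fun_cong[OF eq, of u] that by simp
    have halves: "arc n s (2 * k) = arc n s k \<union> arc n (s + k) k"
      unfolding mult_2 by (rule arc_add)
    have eqH: "f u = g u" if u: "u \<in> arc n t k" for u
    proof -
      obtain i where i: "i < k" "u = (t + i) mod n" using u by (auto simp: arc_def)
      let ?a = "(s + i) mod n" and ?b = "(s + k + i) mod n"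
      have ab: "?a \<in> arc n s k" "?b \<in> arc n (s + k) k" using i by (auto simp: arc_def)
      have fg: "f ?a = f ?b" "g ?a = g ?b" using f g i by (auto simp: square_def)
      from t show ?thesis
      proof
        assume "t = s"
        then have "?b \<in> ?Y" using ab arc_halves_disjoint[OF k, of s] v sub halves by blast
        then show ?thesis using fg eqY i \<open>t = s\<close> by simp
      next
        assume "t = s + k"
        then have "?a \<in> ?Y" using ab arc_halves_disjoint[OF k, of s] v sub halves by blast
        then show ?thesis using fg eqY[of ?a] i \<open>t = s + k\<close> by simp
      qed
    qed
    show "f = g"
    proof
      fix u show "f u = g u"
        using eqY[of u] eqH[of u] v f(1) g(1) PiE_arb[of _ "insert v X" L u]
        by (cases "u \<in> insert v X") auto
    qed
  qed
qed

text \<open>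
  Rosenfeld's counting step: an extension by a colour of \<open>v\<close> that fails contains a square
  through \<open>v\<close>, and it is determined by its values off the half of the square containing \<open>v\<close>.
\<close>

lemma card_squarefree_colourings_insert:
  fixes S T K :: "'i \<Rightarrow> nat"
  assumes fin: "finite X" "\<And>u. u \<in> insert v X \<Longrightarrow> finite (L u)" and v: "v \<notin> X"
    and I: "finite I"
    and half: "\<And>i. i \<in> I \<Longrightarrow> 2 * K i \<le> n \<and> (T i = S i \<or> T i = S i + K i)
      \<and> v \<in> arc n (T i) (K i) \<and> arc n (S i) (2 * K i) \<subseteq> insert v X"
    and cover: "\<And>s k. \<lbrakk>s < n; 1 \<le> k; 2 * k \<le> n; v \<in> arc n s (2 * k); arc n s (2 * k) \<subseteq> insert v X\<rbrakk>
      \<Longrightarrow> \<exists>i\<in>I. S i = s \<and> K i = k"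
  shows "card (L v) * card (squarefree_colourings n L X) \<le> card (squarefree_colourings n L (insert v X))
    + (\<Sum>i\<in>I. card (squarefree_colourings n L (X - arc n (T i) (K i))))"
proof -
  let ?G = "squarefree_colourings n L"
  define E where "E = {f \<in> Pi\<^sub>E (insert v X) L. restrict f X \<in> ?G X}"
  define B where "B i = {f \<in> Pi\<^sub>E (insert v X) L. restrict f X \<in> ?G X \<and> square n f (S i) (K i)}" for i
  have "finite (Pi\<^sub>E (insert v X) L)" using fin by (intro finite_PiE) auto
  then have finE: "finite E" "\<And>i. finite (B i)" unfolding E_def B_def by auto
  have finG: "finite (?G (insert v X))" using fin by (intro finite_squarefree_colourings) auto
  have GX: "f \<in> Pi\<^sub>E X L" if "f \<in> ?G X" for f
    using that by (simp add: squarefree_colourings_def)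
  have "card (L v) * card (?G X) = card (L v \<times> ?G X)"
    by (simp add: card_cartesian_product)
  also have "\<dots> \<le> card E"
  proof (rule card_inj_on_le[where f = "\<lambda>(c, f). f(v := c)"])
    show "inj_on (\<lambda>(c, f). f(v := c)) (L v \<times> ?G X)"
      by (rule inj_on_subset[OF inj_combinator[OF v, of L]]) (use GX in auto)
    show "(\<lambda>(c, f). f(v := c)) ` (L v \<times> ?G X) \<subseteq> E"
    proof clarify
      fix c f assume c: "c \<in> L v" and f: "f \<in> ?G X"
      have "restrict (f(v := c)) X = f"
        using v PiE_arb[OF GX[OF f]] by (auto simp: fun_eq_iff restrict_def)
      then show "f(v := c) \<in> E"
        using c f PiE_fun_upd[OF c GX[OF f]] by (simp add: E_def)
    qed
  qed (rule finE)
  also have "\<dots> \<le> card (?G (insert v X) \<union> (\<Union>i\<in>I. B i))"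
  proof (rule card_mono)
    show "finite (?G (insert v X) \<union> (\<Union>i\<in>I. B i))" using finG I finE by auto
    show "E \<subseteq> ?G (insert v X) \<union> (\<Union>i\<in>I. B i)"
    \<comment> \<open>A square in \<open>f\<close> either passes through \<open>v\<close> and is
      indexed by \<open>I\<close>, or avoids \<open>v\<close> and already occurs in
      \<open>restrict f X\<close>.\<close>
    proof (rule subsetI, rule ccontr)
      fix f assume f: "f \<in> E" "f \<notin> ?G (insert v X) \<union> (\<Union>i\<in>I. B i)"
      then obtain s k where sk: "s < n" "1 \<le> k" "2 * k \<le> n" "arc n s (2 * k) \<subseteq> insert v X"
        "square n f s k"
        unfolding E_def squarefree_colourings_def by auto
      show False
      proof (cases "v \<in> arc n s (2 * k)")
        case True
        then show False using cover[of s k] sk f by (auto simp: E_def B_def)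
      next
        case False
        then have "arc n s (2 * k) \<subseteq> X" using sk by auto
        then show False
          using f(1) sk square_restrict[of n s k X f]
          by (auto simp: E_def squarefree_colourings_def)
      qed
    qed
  qed
  also have "\<dots> \<le> card (?G (insert v X)) + (\<Sum>i\<in>I. card (B i))"
    by (intro order_trans[OF card_Un_le] add_left_mono card_UN_le I)
  also have "(\<Sum>i\<in>I. card (B i)) \<le> (\<Sum>i\<in>I. card (?G (X - arc n (T i) (K i))))"
    unfolding B_def by (intro sum_mono card_squares_le) (use fin half in auto)
  finally show ?thesis by simp
qed

section \<open>Growth of the number of square-free colourings of intervals\<close>

lemma sum_geometric_le:
  fixes q :: real assumes "0 \<le> q" "q < 1"
  shows "(\<Sum>k=1..m. q ^ (k - 1)) \<le> 1 / (1 - q)"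
proof -
  have "(\<Sum>k=1..m. q ^ (k - 1)) = (\<Sum>k<m. q ^ k)"
    by (rule sum.reindex_bij_witness[of _ Suc "\<lambda>k. k - 1"]) auto
  also have "\<dots> = (1 - q ^ m) / (1 - q)" using assms by (simp add: sum_gp_strict)
  also have "\<dots> \<le> 1 / (1 - q)" using assms by (intro divide_right_mono) auto
  finally show ?thesis .
qed

context
  fixes n :: nat and L :: "nat \<Rightarrow> 'c set"
  assumes finL: "\<And>i. i < n \<Longrightarrow> finite (L i)" and cardL: "\<And>i. i < n \<Longrightarrow> 6 \<le> card (L i)"
begin

definition interval_count :: "nat \<Rightarrow> nat \<Rightarrow> real" where
  "interval_count a b = real (card (squarefree_colourings n L {a..<b}))"

text \<open>The form for a vertex at the end of an interval, where each half-length \<open>k\<close>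
  admits a single square through \<open>v\<close>, starting at \<open>S k\<close>. The losses sum to
  at most \<open>4 / 3\<close> of the old count, and at least 6 extensions per colouring were
  available.\<close>

lemma growth_of_decay:
  assumes v: "v < n" "v \<notin> X" "X \<subseteq> {..<n}"
    and half: "\<And>k. k \<in> {1..m} \<Longrightarrow> 2 * k \<le> n \<and> (T k = S k \<or> T k = S k + k)
      \<and> v \<in> arc n (T k) k \<and> arc n (S k) (2 * k) \<subseteq> insert v X"
    and cover: "\<And>s k. \<lbrakk>s < n; 1 \<le> k; 2 * k \<le> n; v \<in> arc n s (2 * k); arc n s (2 * k) \<subseteq> insert v X\<rbrakk>
      \<Longrightarrow> k \<in> {1..m} \<and> S k = s"
    and decay: "\<And>k. k \<in> {1..m} \<Longrightarrow> 4 ^ (k - 1) * real (card (squarefree_colourings n L (X - arc n (T k) k)))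
      \<le> real (card (squarefree_colourings n L X))"
  shows "4 * real (card (squarefree_colourings n L X)) \<le> real (card (squarefree_colourings n L (insert v X)))"
proof -
  let ?N = "\<lambda>X. real (card (squarefree_colourings n L X))"
  have "card (L v) * card (squarefree_colourings n L X) \<le> card (squarefree_colourings n L (insert v X))
    + (\<Sum>k\<in>{1..m}. card (squarefree_colourings n L (X - arc n (T k) k)))"
  proof (rule card_squarefree_colourings_insert[where K = "\<lambda>k. k" and S = S])
    show "finite X" using v(3) by (rule finite_subset) simp
    show "finite (L u)" if "u \<in> insert v X" for u using that v by (intro finL) auto
    show "\<exists>i\<in>{1..m}. S i = s \<and> i = k"
      if "s < n" "1 \<le> k" "2 * k \<le> n" "v \<in> arc n s (2 * k)" "arc n s (2 * k) \<subseteq> insert v X" for s k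
      using cover[OF that] by blast
  qed (use v(2) half in auto)
  then have "real (card (L v)) * ?N X \<le> ?N (insert v X) + (\<Sum>k\<in>{1..m}. ?N (X - arc n (T k) k))"
    unfolding of_nat_mult[symmetric] of_nat_sum[symmetric] of_nat_add[symmetric] of_nat_le_iff .
  moreover have "6 * ?N X \<le> real (card (L v)) * ?N X"
    using cardL[OF v(1)] by (intro mult_right_mono) auto
  moreover have "(\<Sum>k\<in>{1..m}. ?N (X - arc n (T k) k)) \<le> (\<Sum>k\<in>{1..m}. (1/4) ^ (k - 1) * ?N X)"
    using decay by (intro sum_mono) (simp add: power_one_over field_simps)
  moreover have "\<dots> \<le> 1 / (1 - 1/4) * ?N X"
    unfolding sum_distrib_right[symmetric] by (intro mult_right_mono sum_geometric_le) auto
  moreover have "?N X \<ge> 0" by simp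
  ultimately show ?thesis by (simp add: field_simps)
qed

text \<open>Strong induction: growth on shorter intervals, iterated \<open>k - 1\<close> times,
  gives the decay that bounds the squares of half-length \<open>k\<close> ending at
  \<open>b\<close>. As \<open>b < n - 1\<close>, no arc wraps around.\<close>

lemma interval_count_extend_right:
  "a \<le> b \<Longrightarrow> b < n - 1 \<Longrightarrow> 4 * interval_count a b \<le> interval_count a (Suc b)"
proof (induction b rule: less_induct)
  case (less b)
  have iter: "4 ^ d * interval_count a (b - d) \<le> interval_count a b" if "d \<le> b - a" for d
    using that
  proof (induction d)
    case (Suc d)
    then have "4 * interval_count a (b - Suc d) \<le> interval_count a (Suc (b - Suc d))"
      using less.prems by (intro less.IH) auto
    moreover have "Suc (b - Suc d) = b - d" using Suc.prems by auto
    ultimately have "4 ^ d * (4 * interval_count a (b - Suc d)) \<le> 4 ^ d * interval_count a (b - d)"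
      by (intro mult_left_mono) auto
    also note Suc.IH
    finally show ?case using Suc.prems by (simp add: mult_ac)
  qed simp
  define m where "m = (Suc b - a) div 2"
  have ins: "insert b {a..<b} = {a..<Suc b}" using less.prems by auto
  have "4 * real (card (squarefree_colourings n L {a..<b}))
    \<le> real (card (squarefree_colourings n L (insert b {a..<b})))"
  proof (rule growth_of_decay[where m = m and S = "\<lambda>k. Suc b - 2 * k" and T = "\<lambda>k. Suc b - k"])
    fix k assume k: "k \<in> {1..m}"
    then have k': "1 \<le> k" "2 * k \<le> Suc b - a" by (auto simp: m_def)
    have "arc n (Suc b - 2 * k) (2 * k) = {Suc b - 2 * k..<Suc b}"
      using k' less.prems by (subst arc_eq_interval) auto
    moreover have T: "arc n (Suc b - k) k = {Suc b - k..<Suc b}"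
      using k' less.prems by (subst arc_eq_interval) auto
    ultimately show "2 * k \<le> n \<and> (Suc b - k = Suc b - 2 * k \<or> Suc b - k = Suc b - 2 * k + k)
      \<and> b \<in> arc n (Suc b - k) k \<and> arc n (Suc b - 2 * k) (2 * k) \<subseteq> insert b {a..<b}"
      using k' less.prems by auto
    \<comment> \<open>The deleted half contains \<open>b\<close>, which is not in
      \<open>{a..<b}\<close>; only \<open>k - 1\<close> coloured vertices are lost, whence the
      exponent \<open>k - 1\<close>.\<close>
    have "{a..<b} - arc n (Suc b - k) k = {a..<b - (k - 1)}"
      unfolding T using k' by auto
    then show "4 ^ (k - 1) * real (card (squarefree_colourings n L ({a..<b} - arc n (Suc b - k) k)))
      \<le> real (card (squarefree_colourings n L {a..<b}))"
      using iter[of "k - 1"] k' by (simp add: interval_count_def)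
  next
    fix s k assume s: "s < n" "1 \<le> k" "2 * k \<le> n" "b \<in> arc n s (2 * k)"
      "arc n s (2 * k) \<subseteq> insert b {a..<b}"
    have i: "arc n s (2 * k) = {s..<s + 2 * k}"
      by (rule arc_inside(2)[OF s(5) _ s(1)]) (use less.prems in auto)
    have "s \<in> arc n s (2 * k)" "s + 2 * k - 1 \<in> arc n s (2 * k)" unfolding i using s by auto
    then have "a \<le> s" "s + 2 * k - 1 \<le> b" using s(5) less.prems by auto
    moreover have "b < s + 2 * k" using s(4) i by auto
    ultimately show "k \<in> {1..m} \<and> Suc b - 2 * k = s" using s(2) by (auto simp: m_def)
  qed (use less.prems in auto)
  then show ?case unfolding ins interval_count_def .
qed

text \<open>The mirror image, by induction on the length: every square through \<open>a\<close>
  starts at \<open>a\<close>, and its first half is deleted. Both directions are required because a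
  half around the closing vertex cuts the path at both ends.\<close>

lemma interval_count_extend_left:
  "a < b \<Longrightarrow> b \<le> n - 1 \<Longrightarrow> 4 * interval_count (Suc a) b \<le> interval_count a b"
proof (induction "b - a" arbitrary: a rule: less_induct)
  case less
  have iter: "4 ^ d * interval_count (Suc a + d) b \<le> interval_count (Suc a) b" if "d < b - a" for d
    using that
  proof (induction d)
    case (Suc d)
    then have "4 * interval_count (Suc (Suc a + d)) b \<le> interval_count (Suc a + d) b"
      using less.prems by (intro less.hyps) auto
    then have "4 ^ d * (4 * interval_count (Suc (Suc a + d)) b) \<le> 4 ^ d * interval_count (Suc a + d) b"
      by (intro mult_left_mono) auto
    also note Suc.IH
    finally show ?case using Suc.prems by (simp add: mult_ac)
  qed simp
  define m where "m = (b - a) div 2"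
  have ins: "insert a {Suc a..<b} = {a..<b}" using less.prems by auto
  have "4 * real (card (squarefree_colourings n L {Suc a..<b}))
    \<le> real (card (squarefree_colourings n L (insert a {Suc a..<b})))"
  proof (rule growth_of_decay[where m = m and S = "\<lambda>k. a" and T = "\<lambda>k. a"])
    fix k assume k: "k \<in> {1..m}"
    then have k': "1 \<le> k" "2 * k \<le> b - a" by (auto simp: m_def)
    have "arc n a (2 * k) = {a..<a + 2 * k}"
      using k' less.prems by (subst arc_eq_interval) auto
    moreover have T: "arc n a k = {a..<a + k}"
      using k' less.prems by (subst arc_eq_interval) auto
    ultimately show "2 * k \<le> n \<and> (a = a \<or> a = a + k)
      \<and> a \<in> arc n a k \<and> arc n a (2 * k) \<subseteq> insert a {Suc a..<b}"
      using k' less.prems by auto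
    have "{Suc a..<b} - arc n a k = {Suc a + (k - 1)..<b}"
      unfolding T using k' by auto
    then show "4 ^ (k - 1) * real (card (squarefree_colourings n L ({Suc a..<b} - arc n a k)))
      \<le> real (card (squarefree_colourings n L {Suc a..<b}))"
      using iter[of "k - 1"] k' by (simp add: interval_count_def)
  next
    fix s k assume s: "s < n" "1 \<le> k" "2 * k \<le> n" "a \<in> arc n s (2 * k)"
      "arc n s (2 * k) \<subseteq> insert a {Suc a..<b}"
    have i: "arc n s (2 * k) = {s..<s + 2 * k}"
      by (rule arc_inside(2)[OF s(5) _ s(1)]) (use less.prems in auto)
    have "s \<in> arc n s (2 * k)" "s + 2 * k - 1 \<in> arc n s (2 * k)" unfolding i using s by auto
    then have "a \<le> s" "s + 2 * k - 1 < b" using s(5) less.prems by auto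
    moreover have "s \<le> a" using s(4) i by auto
    ultimately show "k \<in> {1..m} \<and> a = s" using s(2) by (auto simp: m_def)
  qed (use less.prems in auto)
  then show ?case unfolding ins interval_count_def .
qed

text \<open>Restore the \<open>q\<close> vertices missing on the right, then the \<open>p\<close>
  vertices missing on the left, with a factor 4 for each.\<close>

lemma interval_count_subinterval:
  assumes "p + q < n"
  shows "4 ^ (p + q) * interval_count p (n - 1 - q) \<le> interval_count 0 (n - 1)"
proof -
  have right: "4 ^ q * interval_count p (n - 1 - q) \<le> interval_count p (n - 1)"
    if "p + q < n" for q using that
  proof (induction q)
    case (Suc q)
    have "4 * interval_count p (n - 1 - Suc q) \<le> interval_count p (Suc (n - 1 - Suc q))"
      using Suc.prems by (intro interval_count_extend_right) auto
    moreover have "Suc (n - 1 - Suc q) = n - 1 - q" using Suc.prems by auto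
    ultimately have "4 ^ q * (4 * interval_count p (n - 1 - Suc q)) \<le> 4 ^ q * interval_count p (n - 1 - q)"
      by (intro mult_left_mono) auto
    also note Suc.IH
    finally show ?case using Suc.prems by (simp add: mult_ac)
  qed simp
  have left: "4 ^ p * interval_count p (n - 1) \<le> interval_count 0 (n - 1)" if "p < n" for p
    using that
  proof (induction p)
    case (Suc p)
    have "4 * interval_count (Suc p) (n - 1) \<le> interval_count p (n - 1)"
      using Suc.prems by (intro interval_count_extend_left) auto
    then have "4 ^ p * (4 * interval_count (Suc p) (n - 1)) \<le> 4 ^ p * interval_count p (n - 1)"
      by (intro mult_left_mono) auto
    also note Suc.IH
    finally show ?case using Suc.prems by (simp add: mult_ac)
  qed simp
  have "4 ^ p * (4 ^ q * interval_count p (n - 1 - q)) \<le> 4 ^ p * interval_count p (n - 1)"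
    using right[OF assms] by (intro mult_left_mono) auto
  also have "\<dots> \<le> interval_count 0 (n - 1)" using left assms by auto
  finally show ?thesis by (simp add: power_add mult.assoc)
qed

text \<open>The empty interval has exactly one colouring, and growth keeps the count positive; this
  turns the final inequality into existence.\<close>

lemma interval_count_pos: "b \<le> n - 1 \<Longrightarrow> 0 < interval_count 0 b"
proof (induction b)
  case 0
  have "squarefree_colourings n L {} = {\<lambda>_. undefined}"
    by (auto simp: squarefree_colourings_def arc_def lessThan_empty_iff)
  then show ?case by (simp add: interval_count_def)
next
  case (Suc b)
  then show ?case using interval_count_extend_right[of 0 b] by auto
qed

section \<open>Closing the cycle at the vertex \<open>n - 1\<close>\<close>

text \<open>The half covers the last \<open>Suc j\<close> vertices and wraps onto the first
  \<open>k - Suc j\<close>. Apart from \<open>n - 1\<close> it removes \<open>j\<close> vertices on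
  the right and \<open>k - 1 - j\<close> on the left, in total \<open>k - 1\<close> for every
  \<open>j\<close>.\<close>

lemma last_half_complement:
  assumes "1 \<le> k" "2 * k \<le> n" "j < k"
  shows "{0..<n - 1} - arc n (n - 1 - j) k = {k - 1 - j..<n - 1 - j}"
    and "n - 1 \<in> arc n (n - 1 - j) k"
proof -
  have "arc n (n - 1 - j) k = arc n (n - 1 - j) (Suc j) \<union> arc n n (k - Suc j)"
    using assms arc_add[of n "n - 1 - j" "Suc j" "k - Suc j"] by simp
  also have "arc n (n - 1 - j) (Suc j) = {n - 1 - j..<n}"
    using assms by (subst arc_eq_interval) auto
  also have "arc n n (k - Suc j) = {..<k - Suc j}"
    using assms by (simp add: arc_def)
  finally have *: "arc n (n - 1 - j) k = {n - 1 - j..<n} \<union> {..<k - Suc j}" .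
  show "{0..<n - 1} - arc n (n - 1 - j) k = {k - 1 - j..<n - 1 - j}"
    "n - 1 \<in> arc n (n - 1 - j) k"
    unfolding * using assms by auto
qed

text \<open>From \<open>k \<le> 2 ^ (k - 1)\<close>, the \<open>2 * k\<close> terms for
  \<open>k\<close> add up to at most \<open>2 * (1/2) ^ (k - 1)\<close>. The resulting bound 4 is
  cruder than \<open>32 / 9\<close> but still below 6.\<close>

lemma closing_squares_bound:
  "(\<Sum>(k, j)\<in>Sigma {1..m} (\<lambda>k. {..<2 * k}). (1/4) ^ (k - 1)) \<le> (4 :: real)"
proof -
  have "(\<Sum>(k, j)\<in>Sigma {1..m} (\<lambda>k. {..<2 * k}). (1/4) ^ (k - 1))
      = (\<Sum>k=1..m. 2 * real k * (1/4) ^ (k - 1))"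
    by (subst sum.Sigma[symmetric]) auto
  also have "\<dots> \<le> (\<Sum>k=1..m. 2 * (1/2) ^ (k - 1))"
  proof (rule sum_mono)
    fix k assume "k \<in> {1..m}"
    then have "k \<le> 2 ^ (k - 1)" by (induction k) (auto simp: Suc_le_eq less_exp)
    then have "real k \<le> 2 ^ (k - 1)" by (metis of_nat_le_iff of_nat_numeral of_nat_power)
    then have "2 * real k * (1/4) ^ (k - 1) \<le> 2 * 2 ^ (k - 1) * (1/4) ^ (k - 1)"
      by (intro mult_right_mono mult_left_mono) auto
    then show "2 * real k * (1/4) ^ (k - 1) \<le> 2 * (1/2) ^ (k - 1)"
      by (simp add: power_mult_distrib[symmetric] mult.assoc)
  qed
  also have "\<dots> \<le> 2 * (1 / (1 - 1/2))"
    unfolding sum_distrib_left[symmetric] by (intro mult_left_mono sum_geometric_le) auto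
  finally show ?thesis by simp
qed

theorem cycle_squarefree_colouring:
  assumes n: "n \<ge> 1"
  obtains f where "\<And>i. i < n \<Longrightarrow> f i \<in> L i"
    "\<And>s k. \<lbrakk>1 \<le> k; 2 * k \<le> n\<rbrakk> \<Longrightarrow> \<not> square n f s k"
proof -
  let ?G = "squarefree_colourings n L" and ?X = "{0..<n - 1}"
  \<comment> \<open>A pair \<open>(k, j)\<close> stands for the square of half-length
    \<open>k\<close> in which \<open>n - 1\<close> has offset \<open>j\<close>. Subtraction does not
    truncate, as \<open>j < 2 * k \<le> n\<close>. \<open>T\<close> is the start of the first half
    if \<open>j < k\<close> and of the second half otherwise.\<close>
  define I where "I = Sigma {1..n div 2} (\<lambda>k. {..<2 * k})"
  define S where "S = (\<lambda>(k :: nat, j). n - 1 - j)"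
  define T where "T = (\<lambda>(k, j). n - 1 - (if j < k then j else j - k))"
  have ins: "insert (n - 1) ?X = {..<n}" using n by auto
  have bound: "card (L (n - 1)) * card (?G ?X) \<le> card (?G (insert (n - 1) ?X))
    + (\<Sum>i\<in>I. card (?G (?X - arc n (T i) (fst i))))"
  proof (rule card_squarefree_colourings_insert)
    fix i assume "i \<in> I"
    then obtain k j where i: "i = (k, j)" "1 \<le> k" "2 * k \<le> n" "j < 2 * k" by (auto simp: I_def)
    have "T i = S i \<or> T i = S i + k" using i by (auto simp: T_def S_def)
    moreover have "n - 1 \<in> arc n (T i) k"
      using i last_half_complement(2)[of k "if j < k then j else j - k"] by (auto simp: T_def)
    moreover have "arc n (S i) (2 * k) \<subseteq> insert (n - 1) ?X"
      unfolding ins arc_def using n by auto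
    ultimately show "2 * fst i \<le> n \<and> (T i = S i \<or> T i = S i + fst i)
      \<and> n - 1 \<in> arc n (T i) (fst i) \<and> arc n (S i) (2 * fst i) \<subseteq> insert (n - 1) ?X"
      using i by simp
  next
    fix s k assume s: "s < n" "1 \<le> k" "2 * k \<le> n" "n - 1 \<in> arc n s (2 * k)"
    then obtain i where i: "i < 2 * k" "(s + i) mod n = n - 1" by (auto simp: arc_def)
    \<comment> \<open>Offsets below \<open>n\<close> are determined modulo \<open>n\<close>, so the
      offset \<open>i\<close> of \<open>n - 1\<close> is \<open>n - 1 - s\<close>.\<close>
    have "n - 1 - s < 2 * k"
      using add_mod_inj[of s i n "n - 1 - s"] i s by auto
    then show "\<exists>i\<in>I. S i = s \<and> fst i = k"
      using s by (intro bexI[of _ "(k, n - 1 - s)"]) (auto simp: I_def S_def)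
  qed (use n in \<open>auto simp: I_def intro: finL\<close>)
  define N where "N = real (card (?G ?X))"
  have N: "0 < N" using interval_count_pos[of "n - 1"] by (simp add: N_def interval_count_def)
  have each: "real (card (?G (?X - arc n (T i) (fst i)))) \<le> (case i of (k, j) \<Rightarrow> (1/4) ^ (k - 1)) * N"
    if iI: "i \<in> I" for i
  proof -
    obtain k j where i: "i = (k, j)" "1 \<le> k" "2 * k \<le> n" "j < 2 * k" using iI by (auto simp: I_def)
    define j' where "j' = (if j < k then j else j - k)"
    have j': "j' < k" using i by (auto simp: j'_def)
    have "4 ^ (k - 1 - j' + j') * interval_count (k - 1 - j') (n - 1 - j') \<le> interval_count 0 (n - 1)"
      using j' i by (intro interval_count_subinterval) auto
    then have "4 ^ (k - 1) * real (card (?G {k - 1 - j'..<n - 1 - j'})) \<le> N"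
      using j' by (simp add: interval_count_def N_def)
    moreover have "?X - arc n (T i) (fst i) = {k - 1 - j'..<n - 1 - j'}"
      using last_half_complement(1)[OF i(2,3) j'] by (simp add: T_def i j'_def)
    ultimately show ?thesis using i by (simp add: power_one_over field_simps)
  qed
  have "6 * N \<le> real (card (L (n - 1))) * N"
    using cardL[of "n - 1"] n N by (intro mult_right_mono) auto
  also have "\<dots> \<le> real (card (?G {..<n})) + (\<Sum>i\<in>I. real (card (?G (?X - arc n (T i) (fst i)))))"
    using bound unfolding N_def ins
      of_nat_mult[symmetric] of_nat_sum[symmetric] of_nat_add[symmetric] of_nat_le_iff .
  also have "\<dots> \<le> real (card (?G {..<n})) + (\<Sum>i\<in>I. case i of (k, j) \<Rightarrow> (1/4) ^ (k - 1)) * N"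
    unfolding sum_distrib_right by (intro add_left_mono sum_mono each)
  also have "\<dots> \<le> real (card (?G {..<n})) + 4 * N"
    unfolding I_def using closing_squares_bound N by (intro add_left_mono mult_right_mono) auto
  \<comment> \<open>At least \<open>6 * N\<close> extensions exist and at most \<open>4 * N\<close>
    of them contain a square.\<close>
  finally have "card (?G {..<n}) > 0" using N by simp
  then obtain f where f: "f \<in> ?G {..<n}" by (metis card.empty equals0I less_irrefl)
  show ?thesis
  proof (rule that)
    show "f i \<in> L i" if "i < n" for i using f that by (auto simp: squarefree_colourings_def)
    fix s k :: nat assume k: "1 \<le> k" "2 * k \<le> n"
    \<comment> \<open>\<open>squarefree_colourings\<close> only speaks of starts below
      \<open>n\<close>, so an arbitrary start is reduced modulo \<open>n\<close>.\<close>
    have "arc n (s mod n) (2 * k) \<subseteq> {..<n}" using n by (auto simp: arc_def)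
    then have "\<not> square n f (s mod n) k"
      using f k n by (auto simp: squarefree_colourings_def)
    then show "\<not> square n f s k"
      by (simp add: square_def mod_add_left_eq add.assoc)
  qed
qed

end

section \<open>From squares on the rows to repetitions along faces of the prism\<close>

lemma repetition_rev: "repetition (rev r) \<Longrightarrow> repetition r"
proof -
  assume "repetition (rev r)"
  then obtain k where k: "k \<ge> 1" "length r = 2 * k" "\<And>i. i < k \<Longrightarrow> rev r ! i = rev r ! (k + i)"
    by (auto simp: repetition_def)
  have "r ! i = r ! (k + i)" if "i < k" for i
    using k(3)[of "k - 1 - i"] k that by (simp add: rev_nth)
  then show ?thesis using k by (auto simp: repetition_def)
qed

text \<open>A path that advances by one in a row returns to its start after \<open>n\<close> steps,
  so distinctness forces \<open>2 * k \<le> n\<close>, and a repetition is then a square of the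
  row.\<close>

lemma cyclic_walk_nonrepetitive:
  assumes n: "n \<ge> 1" and sq: "\<And>s k. \<lbrakk>1 \<le> k; 2 * k \<le> n\<rbrakk> \<Longrightarrow> \<not> square n (\<lambda>i. \<phi> (i, t)) s k"
    and p: "distinct p" "p \<noteq> []" "p ! 0 = (s, t)" "s < n"
    and step: "\<And>m i. Suc m < length p \<Longrightarrow> p ! m = (i, t) \<Longrightarrow> p ! Suc m = (Suc i mod n, t)"
  shows "\<not> repetition (map \<phi> p)"
proof
  assume "repetition (map \<phi> p)"
  then obtain k where k: "k \<ge> 1" "length p = 2 * k" "\<And>i. i < k \<Longrightarrow> \<phi> (p ! i) = \<phi> (p ! (k + i))"
    by (auto simp: repetition_def)
  have nth: "p ! m = ((s + m) mod n, t)" if "m < length p" for m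
    using that by (induction m) (use p step in \<open>auto simp: mod_Suc_eq\<close>)
  have "2 * k \<le> n"
  proof (rule ccontr)
    assume "\<not> 2 * k \<le> n"
    then have "p ! 0 = p ! n" "n < length p" using nth[of n] nth[of 0] k by auto
    then show False using p n nth_eq_iff_index_eq[of p 0 n] by auto
  qed
  moreover have "square n (\<lambda>i. \<phi> (i, t)) s k"
    using k nth by (auto simp: square_def add.assoc)
  ultimately show False using sq k by blast
qed

context
  fixes n :: nat and \<phi> :: "nat \<times> nat \<Rightarrow> 'c"
  assumes n: "n \<ge> 3"
    and row: "\<And>s k t. \<lbrakk>t < 2; 1 \<le> k; 2 * k \<le> n\<rbrakk> \<Longrightarrow> \<not> square n (\<lambda>i. \<phi> (i, t)) s k"
    and rung: "\<And>i. i < n \<Longrightarrow> \<phi> (i, 0) \<noteq> \<phi> (i, 1)"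
    and diagonal: "\<And>i. i < n \<Longrightarrow> \<phi> (i, 0) \<noteq> \<phi> (Suc i mod n, 1)"
begin

lemma boundary_nonrepetitive:
  assumes p: "distinct p" "follows_boundary (prism n) (prism_rot n) p"
  shows "\<not> repetition (map \<phi> p)"
proof (cases "p = []")
  case True
  then show ?thesis by (simp add: repetition_def)
next
  case False
  let ?f = "face_succ (prism_rot n)"
  obtain a where a: "a \<in> parcs (prism n)" and nth: "\<And>m. m < length p \<Longrightarrow> p ! m = fst ((?f ^^ m) a)"
    using p(2) by (auto simp: follows_boundary_def)
  consider i where "i < n" "a = inner_arc n i" | i where "i < n" "a = outer_arc n i"
    | i where "i < n" "a \<in> quad_arcs n i"
    using a unfolding parcs_prism_faces[of n] by auto
  then show ?thesis
  proof cases
    case 1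
    have ex: "\<exists>j<n. (?f ^^ m) a = inner_arc n (Suc j mod n) \<and> (?f ^^ Suc m) a = inner_arc n j" for m
    proof (induction m)
      case 0
      obtain j where "j < n" "i = Suc j mod n"
        using 1 pred_mod_if[of i n]
        by (intro that[of "if i = 0 then n - 1 else i - 1"]) auto
      then show ?case using 1 face_succ_inner[OF n] by auto
    next
      case (Suc m)
      then obtain j where j: "j < n" "(?f ^^ Suc m) a = inner_arc n j" by auto
      obtain l where "l < n" "j = Suc l mod n"
        using j pred_mod_if[of j n]
        by (intro that[of "if j = 0 then n - 1 else j - 1"]) auto
      then show ?case using j face_succ_inner[OF n, of l] by auto
    qed
    \<comment> \<open>\<open>face_succ\<close> runs around the inner face with falling first
      components, so it is the reversed path that advances.\<close>
    have "\<not> repetition (map \<phi> (rev p))"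
    proof (rule cyclic_walk_nonrepetitive[where n = n and t = 0 and s = "fst (rev p ! 0)"])
      have last: "rev p ! 0 = fst ((?f ^^ (length p - 1)) a)"
        using False nth[of "length p - 1"] by (simp add: rev_nth)
      obtain j where "j < n" "(?f ^^ (length p - 1)) a = inner_arc n (Suc j mod n)"
        using ex by blast
      then show "rev p ! 0 = (fst (rev p ! 0), 0)" "fst (rev p ! 0) < n"
        using n unfolding last by (auto simp: inner_arc_def)
      fix m i assume m: "Suc m < length (rev p)" "rev p ! m = (i, 0)"
      define l where "l = length p - Suc (Suc m)"
      have l: "rev p ! Suc m = p ! l" "rev p ! m = p ! Suc l" "Suc l < length p"
        using m(1) by (auto simp: rev_nth l_def Suc_diff_Suc)
      obtain j where "j < n" "(?f ^^ l) a = inner_arc n (Suc j mod n)" "(?f ^^ Suc l) a = inner_arc n j"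
        using ex by blast
      then show "rev p ! Suc m = (Suc i mod n, 0)"
        using nth[of l] nth[of "Suc l"] l m by (auto simp: inner_arc_def)
    qed (use n p row False in auto)
    then show ?thesis using repetition_rev by (metis rev_map rev_rev_ident)
  next
    case 2
    have ex: "\<exists>j<n. (?f ^^ m) a = outer_arc n j \<and> (?f ^^ Suc m) a = outer_arc n (Suc j mod n)" for m
    proof (induction m)
      case (Suc m)
      then obtain j where "(?f ^^ Suc m) a = outer_arc n (Suc j mod n)" by auto
      moreover have "Suc j mod n < n" using n by simp
      ultimately show ?case using face_succ_outer[OF n, of "Suc j mod n"] by auto
    qed (use 2 face_succ_outer[OF n] in auto)
    show ?thesis
    proof (rule cyclic_walk_nonrepetitive[where n = n and t = 1 and s = i])
      show "p ! 0 = (i, 1)" using nth[of 0] False 2 by (simp add: outer_arc_def)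
      fix m i assume m: "Suc m < length p" "p ! m = (i, 1)"
      then show "p ! Suc m = (Suc i mod n, 1)"
        using ex[of m] nth[of m] nth[of "Suc m"] by (auto simp: outer_arc_def)
    qed (use n p row False 2 in auto)
  next
    case 3
    note f = face_succ_quad[OF n 3(1)]
    \<comment> \<open>A square of half-length 1 is an edge with equally coloured ends.\<close>
    have horizontal: "\<phi> (i, t) \<noteq> \<phi> (Suc i mod n, t)" if "t < 2" for t
      using row[OF that, of 1 i] n 3 by (auto simp: square_def)
    have "Suc i mod n < n" using n by auto
    note facts = horizontal[of 0] horizontal[of 1] rung[OF 3(1)] rung[OF this] diagonal[OF 3(1)]
    show ?thesis
    proof
      assume "repetition (map \<phi> p)"
      then obtain k where k: "k \<ge> 1" "length p = 2 * k" "\<And>i. i < k \<Longrightarrow> \<phi> (p ! i) = \<phi> (p ! (k + i))"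
        by (auto simp: repetition_def)
      \<comment> \<open>The walk closes after four steps, so a path on a quadrangle has at most four
        vertices.\<close>
      have "(?f ^^ 4) a = a" using 3(2) f unfolding quad_arcs_def
        by (elim insertE emptyE) (simp_all add: numeral_eq_Suc)
      then have "\<not> 4 < length p"
        using nth[of 0] nth[of 4] nth_eq_iff_index_eq[OF p(1), of 0 4] False by auto
      then consider "k = 1" | "k = 2" using k by linarith
      then show False
      proof cases
        case 1
        \<comment> \<open>Here two adjacent corners agree, against \<open>horizontal\<close> or
          \<open>rung\<close>.\<close>
        then have "\<phi> (fst a) = \<phi> (fst (?f a))" using k(3)[of 0] nth[of 0] nth[of 1] k by simp
        then show False using 3(2) f facts unfolding quad_arcs_def
          by (elim insertE emptyE) auto
      next
        case 2
        \<comment> \<open>Here opposite corners agree on both diagonals, wherever the walk starts;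
          one of them is excluded by \<open>diagonal\<close>.\<close>
        then have "\<phi> (fst a) = \<phi> (fst (?f (?f a)))" "\<phi> (fst (?f a)) = \<phi> (fst (?f (?f (?f a))))"
          using k(3)[of 0] k(3)[of 1] nth[of 0] nth[of 1] nth[of 2] nth[of 3] k(2) 2
          by (simp_all add: numeral_2_eq_2 numeral_3_eq_3)
        then show False using 3(2) f facts unfolding quad_arcs_def
          by (elim insertE emptyE) auto
      qed
    qed
  qed
qed

lemma prism_facial_nonrepetitive: "facial_nonrepetitive (prism n) (prism_rot n) \<phi>"
  unfolding facial_nonrepetitive_def facial_path_def
  using boundary_nonrepetitive repetition_rev by (metis distinct_rev rev_map rev_rev_ident)

end

section \<open>Colouring the prism from lists of size 8\<close>

theorem theorem11:
  fixes n :: nat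
  assumes "n \<ge> 3"
  shows "pi_fl (prism n) (prism_rot n) \<le> 8"
proof -
  have "facial_nonrep_choosable (prism n) (prism_rot n) 8"
    unfolding facial_nonrep_choosable_def
  proof (intro allI impI)
    fix L :: "nat \<times> nat \<Rightarrow> nat set"
    assume L: "\<forall>v\<in>pverts (prism n). L v \<subseteq> {1..} \<and> (finite (L v) \<longrightarrow> 8 \<le> card (L v))"
    \<comment> \<open>Lists may be infinite, while the counting needs finite ones; each list is cut
      down to exactly 8 colours.\<close>
    have "\<exists>A. A \<subseteq> L v \<and> finite A \<and> card A = 8" if "v \<in> pverts (prism n)" for v
      using L that by (metis infinite_arbitrarily_large obtain_subset_with_card_n finite_subset)
    then obtain M where M: "\<And>v. v \<in> pverts (prism n) \<Longrightarrow> M v \<subseteq> L v \<and> finite (M v) \<and> card (M v) = 8"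
      by metis
    have M': "M (i, t) \<subseteq> L (i, t)" "finite (M (i, t))" "card (M (i, t)) = 8" if "i < n" "t < 2" for i t
      using M[of "(i, t)"] that by (auto simp: pverts_prism)
    obtain g where g: "\<And>i. i < n \<Longrightarrow> g i \<in> M (i, 1)"
      "\<And>s k. \<lbrakk>1 \<le> k; 2 * k \<le> n\<rbrakk> \<Longrightarrow> \<not> square n g s k"
      using cycle_squarefree_colouring[of n "\<lambda>i. M (i, 1)"] M' assms by auto
    \<comment> \<open>Without \<open>g i\<close> the rungs are safe, without
      \<open>g (Suc i mod n)\<close> the diagonals; at least 6 colours remain for the inner
      cycle.\<close>
    define M0 where "M0 i = M (i, 0) - {g i, g (Suc i mod n)}" for i
    have "finite (M0 i)" "6 \<le> card (M0 i)" if "i < n" for i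
    proof -
      show "finite (M0 i)" using M'[OF that] by (simp add: M0_def)
      have "card {g i, g (Suc i mod n)} \<le> 2" by (simp add: card_insert_if)
      then show "6 \<le> card (M0 i)"
        using diff_card_le_card_Diff[of "{g i, g (Suc i mod n)}" "M (i, 0)"] M'[OF that]
        by (simp add: M0_def)
    qed
    then obtain h where h: "\<And>i. i < n \<Longrightarrow> h i \<in> M0 i"
      "\<And>s k. \<lbrakk>1 \<le> k; 2 * k \<le> n\<rbrakk> \<Longrightarrow> \<not> square n h s k"
      using cycle_squarefree_colouring[of n M0] assms by auto
    define \<phi> where "\<phi> = (\<lambda>(i, t :: nat). if t = 0 then h i else g i)"
    have "\<phi> v \<in> L v" if "v \<in> pverts (prism n)" for v
    proof -
      obtain i t where v: "v = (i, t)" "i < n" "t = 0 \<or> t = 1"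
        using \<open>v \<in> pverts (prism n)\<close> by (auto simp: pverts_prism less_2)
      then show ?thesis
        using g(1)[of i] h(1)[of i] M'(1)[of i 0] M'(1)[of i 1] by (auto simp: \<phi>_def M0_def)
    qed
    moreover have "facial_nonrepetitive (prism n) (prism_rot n) \<phi>"
    proof (rule prism_facial_nonrepetitive[OF assms])
      show "\<not> square n (\<lambda>i. \<phi> (i, t)) s k" if "1 \<le> k" "2 * k \<le> n" for s k t
        using that g(2) h(2) by (cases "t = 0") (auto simp: \<phi>_def)
    qed (use h(1) in \<open>auto simp: \<phi>_def M0_def\<close>)
    ultimately show "\<exists>\<phi>. (\<forall>v\<in>pverts (prism n). \<phi> v \<in> L v) \<and> facial_nonrepetitive (prism n) (prism_rot n) \<phi>"
      by blast
  qed
  then show ?thesis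
    unfolding pi_fl_def by (intro INF_lower2[of 8]) (auto simp: numeral_eq_enat)
qed

end
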